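(* Let $G^{(0)}$ be a simple undirected graph on a finite vertex set $V$, let $\alpha\le\beta$ be arbitrary thresholds, let $(C^{(t)})_{t\ge0}$ be an arbitrary sequence of sets of unordered pairs of distinct vertices of $V$, let $f$ be a proper function and $g$ a degree-like function, and let $\mathcal{E}^{(t)}(u,v)=f(g_{G^{(t)}}(u),g_{G^{(t)}}(v))$. Then the process converges, i.e. there exists $t$ with $G^{(t)}=G^{(t+1)}$.
   Context: Threshold network process: $G^{(t)}=(V,E^{(t)})$ simple undirected graphs, $t=0,1,2,\dots$; $N_G(u)$ is the neighborhood of $u$ in $G$. Given thresholds $\alpha\le\beta$, interaction sets $C^{(t)}$ and energies $\mathcal{E}^{(t)}(u,v)$, $G^{(t+1)}$ is obtained from $G^{(t)}$: for $\{u,v\}\in C^{(t)}$, if $\mathcal{E}^{(t)}(u,v)<\alpha$ the pair is a non-edge at $t+1$; if $\alpha\le\mathcal{E}^{(t)}(u,v)<\beta$ its status is unchanged; if $\mathcal{E}^{(t)}(u,v)\ge\beta$ it is an edge at $t+1$; pairs not in $C^{(t)}$ are unchanged. A function $f:\mathbb{R}^2\to\mathbb{R}$ is proper if it is symmetric and non-decreasing in each argument. A function $g$ assigning a real number $g_H(u)$ to every graph $H$ on $V$ and vertex $u$ is degree-like if for all graphs $H,H'$ on $V$ and vertices $u,v$, $N_H(u)\supseteq N_{H'}(v)$ implies $g_H(u)\ge g_{H'}(v)$. *)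

theory Defs
  imports Complex_Main "HOL-Library.Ramsey"
begin

text \<open>A simple undirected graph on a fixed vertex set \<open>V\<close> is identified with its edge set, a
  subset of \<open>nsets V 2\<close>, the unordered pairs of distinct elements of \<open>V\<close>.\<close>

definition graph_on :: "'a set \<Rightarrow> 'a set set \<Rightarrow> bool" where
  "graph_on V H \<longleftrightarrow> H \<subseteq> nsets V 2"

definition neighborhood :: "'a set set \<Rightarrow> 'a \<Rightarrow> 'a set" where
  "neighborhood H u = {w. {u, w} \<in> H}"

definition proper :: "(real \<Rightarrow> real \<Rightarrow> real) \<Rightarrow> bool" where
  "proper f \<longleftrightarrow> (\<forall>x y. f x y = f y x) \<and> (\<forall>y. mono (\<lambda>x. f x y)) \<and> (\<forall>x. mono (\<lambda>y. f x y))"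

definition degree_like :: "'a set \<Rightarrow> ('a set set \<Rightarrow> 'a \<Rightarrow> real) \<Rightarrow> bool" where
  "degree_like V g \<longleftrightarrow>
     (\<forall>H H'. \<forall>u\<in>V. \<forall>v\<in>V. graph_on V H \<longrightarrow> graph_on V H' \<longrightarrow>
        neighborhood H' v \<subseteq> neighborhood H u \<longrightarrow> g H' v \<le> g H u)"

text \<open>The rule below ranges over ordered pairs, so it constrains each unordered pair twice; the
  two constraints agree because energies are symmetric (see \<open>ex1_threshold_step\<close>).\<close>

definition threshold_step ::
  "'a set \<Rightarrow> real \<Rightarrow> real \<Rightarrow> 'a set set \<Rightarrow> ('a \<Rightarrow> 'a \<Rightarrow> real) \<Rightarrow> 'a set set \<Rightarrow> 'a set set \<Rightarrow> bool" where
  "threshold_step V \<alpha> \<beta> C e H H' \<longleftrightarrow>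
     (\<forall>u\<in>V. \<forall>v\<in>V. u \<noteq> v \<longrightarrow>
        ({u, v} \<in> C \<longrightarrow>
           (e u v < \<alpha> \<longrightarrow> {u, v} \<notin> H') \<and>
           (\<alpha> \<le> e u v \<and> e u v < \<beta> \<longrightarrow> ({u, v} \<in> H' \<longleftrightarrow> {u, v} \<in> H)) \<and>
           (\<beta> \<le> e u v \<longrightarrow> {u, v} \<in> H')) \<and>
        ({u, v} \<notin> C \<longrightarrow> ({u, v} \<in> H' \<longleftrightarrow> {u, v} \<in> H)))"

definition threshold_process ::
  "'a set \<Rightarrow> real \<Rightarrow> real \<Rightarrow> (nat \<Rightarrow> 'a set set) \<Rightarrow> (nat \<Rightarrow> 'a \<Rightarrow> 'a \<Rightarrow> real) \<Rightarrow> (nat \<Rightarrow> 'a set set) \<Rightarrow> bool" where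
  "threshold_process V \<alpha> \<beta> C \<E> G \<longleftrightarrow>
     (\<forall>t. graph_on V (G t)) \<and>
     (\<forall>t. threshold_step V \<alpha> \<beta> (C t) (\<E> t) (G t) (G (Suc t)))"

lemma ex1_threshold_step:
  assumes "\<alpha> \<le> \<beta>" and sym: "\<And>u v. e u v = e v u"
  shows "\<exists>!H'. graph_on V H' \<and> threshold_step V \<alpha> \<beta> C e H H'"
proof (rule ex_ex1I)
  define P where "P u v \<longleftrightarrow> (if {u, v} \<in> C then \<beta> \<le> e u v \<or> \<alpha> \<le> e u v \<and> {u, v} \<in> H
    else {u, v} \<in> H)" for u v
  define K where "K = {{u, v} |u v. u \<in> V \<and> v \<in> V \<and> u \<noteq> v \<and> P u v}"
  have P_sym: "P u v \<longleftrightarrow> P v u" for u v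
    unfolding P_def insert_commute[of u v] sym[of u v] by (rule refl)
  have K_iff: "{u, v} \<in> K \<longleftrightarrow> P u v" if "u \<in> V" "v \<in> V" "u \<noteq> v" for u v
    using that P_sym[of u v] unfolding K_def mem_Collect_eq doubleton_eq_iff by blast
  have "graph_on V K"
    by (auto simp: graph_on_def K_def nsets_def)
  moreover have "threshold_step V \<alpha> \<beta> C e H K"
    unfolding threshold_step_def
  proof (intro ballI impI)
    fix u v assume "u \<in> V" "v \<in> V" "u \<noteq> v"
    from K_iff[OF this] show "({u, v} \<in> C \<longrightarrow>
           (e u v < \<alpha> \<longrightarrow> {u, v} \<notin> K) \<and>
           (\<alpha> \<le> e u v \<and> e u v < \<beta> \<longrightarrow> ({u, v} \<in> K \<longleftrightarrow> {u, v} \<in> H)) \<and>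
           (\<beta> \<le> e u v \<longrightarrow> {u, v} \<in> K)) \<and>
        ({u, v} \<notin> C \<longrightarrow> ({u, v} \<in> K \<longleftrightarrow> {u, v} \<in> H))"
      using \<open>\<alpha> \<le> \<beta>\<close> unfolding P_def by (cases "{u, v} \<in> C") auto
  qed
  ultimately show "\<exists>H'. graph_on V H' \<and> threshold_step V \<alpha> \<beta> C e H H'"
    by blast
next
  fix H1 H2
  assume H1: "graph_on V H1 \<and> threshold_step V \<alpha> \<beta> C e H H1"
    and H2: "graph_on V H2 \<and> threshold_step V \<alpha> \<beta> C e H H2"
  have "{u, v} \<in> H1 \<longleftrightarrow> {u, v} \<in> H2" if "u \<in> V" "v \<in> V" "u \<noteq> v" for u v
    using H1 H2 that unfolding threshold_step_def by (meson not_le)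
  moreover have "\<exists>u v. x = {u, v} \<and> u \<in> V \<and> v \<in> V \<and> u \<noteq> v" if "x \<in> H1 \<union> H2" for x
  proof -
    from that H1 H2 have "x \<subseteq> V" "card x = 2"
      unfolding graph_on_def nsets_def by blast+
    then show ?thesis
      by (auto simp: card_2_iff)
  qed
  ultimately show "H1 = H2"
    by blast
qed

end

theory Submission
  imports Defs
begin

text \<open>Suppose that the process never stops. From some time \<open>T\<close> on, only pairs that are switched
  infinitely often are switched. Let \<open>m\<close> be the least value of \<open>g\<close> at an endpoint of an edge being
  inserted after \<open>T\<close>, say of \<open>{u, v}\<close> with values \<open>a\<close> and \<open>m\<close>, and let \<open>M\<close> be the greatest value
  of \<open>g\<close> at an endpoint of an edge being deleted after \<open>T\<close>, say of \<open>{u', v'}\<close> with values \<open>M\<close> and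
  \<open>b\<close>. Until the vertex \<open>u\<close> next loses an edge its neighborhood only grows, so \<open>a \<le> M\<close>; until
  \<open>v'\<close> next gains an edge its neighborhood only shrinks, so \<open>m \<le> b\<close>. Hence
  \<open>\<beta> \<le> f a m \<le> f M b < \<alpha>\<close>, a contradiction.\<close>

text \<open>If nothing were lost at any time \<open>q\<close> \<ge> \<open>r\<close> with
  \<open>X r\<close> inside \<open>X q\<close>, induction would keep \<open>X r\<close> inside every
  later \<open>X n\<close>. Then \<open>X\<close> would grow at every step from \<open>r\<close> on,
  so \<open>x\<close> could not disappear between \<open>i\<close> and \<open>j\<close>. The time
  \<open>r\<close> is kept apart from \<open>i\<close> because \<open>x\<close> need not lie in
  \<open>X r\<close>.\<close>

lemma first_loss:
  fixes X :: "nat \<Rightarrow> 'b set"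
  assumes "x \<in> X i" "x \<notin> X j" "r \<le> i" "i \<le> j"
  obtains q y where "r \<le> q" "X r \<subseteq> X q" "y \<in> X q" "y \<notin> X (Suc q)"
proof (rule ccontr)
  assume "\<not> thesis"
  with that have grow: "X q \<subseteq> X (Suc q)" if "r \<le> q" "X r \<subseteq> X q" for q
    using that by blast
  have sub: "X r \<subseteq> X n" if "r \<le> n" for n
    using that by (induction n rule: dec_induct) (use grow in blast)+
  have "X i \<subseteq> X j"
    using \<open>i \<le> j\<close>
  proof (induction j rule: dec_induct)
    case (step n)
    then show ?case
      using grow sub \<open>r \<le> i\<close>
      by (meson order_trans)
  qed simp
  with assms show False
    by blast
qed

lemma first_gain:
  fixes X :: "nat \<Rightarrow> 'b set"
  assumes "x \<notin> X i" "x \<in> X j" "r \<le> i" "i \<le> j"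
  obtains q y where "r \<le> q" "X q \<subseteq> X r" "y \<notin> X q" "y \<in> X (Suc q)"
  using first_loss[of x "\<lambda>t. - X t" i j r] assms by auto

text \<open>A single \<open>p\<close> that is eventually always present or eventually always absent
  stops switching; otherwise the conclusion is immediate. Finiteness of \<open>P\<close> merges the
  times for the individual \<open>p\<close> into one.\<close>

lemma eventually_switch_imp_recurrent:
  fixes G :: "nat \<Rightarrow> 'b set"
  assumes "finite P"
  shows "\<forall>\<^sub>F t in sequentially. \<forall>p\<in>P. (p \<in> G t) \<noteq> (p \<in> G (Suc t)) \<longrightarrow>
           (\<exists>\<^sub>F s in sequentially. p \<in> G s) \<and> (\<exists>\<^sub>F s in sequentially. p \<notin> G s)"
proof (intro eventually_ball_finite[OF assms] ballI)
  fix p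
  consider "(\<exists>\<^sub>F s in sequentially. p \<in> G s) \<and> (\<exists>\<^sub>F s in sequentially. p \<notin> G s)"
    | "\<forall>\<^sub>F s in sequentially. p \<in> G s" | "\<forall>\<^sub>F s in sequentially. p \<notin> G s"
    unfolding frequently_def by auto
  then show "\<forall>\<^sub>F t in sequentially. (p \<in> G t) \<noteq> (p \<in> G (Suc t)) \<longrightarrow>
      (\<exists>\<^sub>F s in sequentially. p \<in> G s) \<and> (\<exists>\<^sub>F s in sequentially. p \<notin> G s)"
  proof cases
    case 2
    then have "\<forall>\<^sub>F s in sequentially. p \<in> G (Suc s)"
      by (subst eventually_sequentially_Suc)
    with 2 show ?thesis
      by eventually_elim simp
  next
    case 3
    then have "\<forall>\<^sub>F s in sequentially. p \<notin> G (Suc s)"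
      by (subst eventually_sequentially_Suc)
    with 3 show ?thesis
      by eventually_elim simp
  qed simp
qed

lemma graph_on_edgeD:
  assumes "graph_on V H" "{u, v} \<in> H"
  shows "u \<in> V" "v \<in> V" "u \<noteq> v"
  using assms by (auto simp: graph_on_def nsets_def)

lemma graph_on_edgeE:
  assumes "graph_on V H" "p \<in> H"
  obtains u v where "p = {u, v}"
proof -
  from assms have "card p = 2"
    by (auto simp: graph_on_def nsets_def)
  with that show ?thesis
    by (auto simp: card_2_iff)
qed

text \<open>Below \<open>\<beta>\<close>, each case of the rule either deletes the pair or leaves
  its status unchanged.\<close>

lemma threshold_step_gain:
  assumes "threshold_step V \<alpha> \<beta> C e H H'" "u \<in> V" "v \<in> V" "u \<noteq> v"
    and "{u, v} \<notin> H" "{u, v} \<in> H'"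
  shows "\<beta> \<le> e u v"
  using assms unfolding threshold_step_def by (meson not_le)

lemma threshold_step_loss:
  assumes "threshold_step V \<alpha> \<beta> C e H H'" "u \<in> V" "v \<in> V" "u \<noteq> v"
    and "{u, v} \<in> H" "{u, v} \<notin> H'"
  shows "e u v < \<alpha>"
  using assms unfolding threshold_step_def by (meson not_le)

theorem theorem3:
  fixes V :: "'a set" and \<alpha> \<beta> :: real
    and C :: "nat \<Rightarrow> 'a set set" and G :: "nat \<Rightarrow> 'a set set"
    and f :: "real \<Rightarrow> real \<Rightarrow> real" and g :: "'a set set \<Rightarrow> 'a \<Rightarrow> real"
  assumes "finite V"
    and "\<alpha> \<le> \<beta>"
    and "\<And>t. C t \<subseteq> nsets V 2"
    and "proper f"
    and "degree_like V g"
    and "threshold_process V \<alpha> \<beta> C (\<lambda>t u v. f (g (G t) u) (g (G t) v)) G"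
  shows "\<exists>t. G t = G (Suc t)"
proof (rule ccontr)
  assume "\<nexists>t. G t = G (Suc t)"
  then have never: "G t \<noteq> G (Suc t)" for t
    by blast
  have graph: "graph_on V (G t)" for t
    using assms(6) by (simp add: threshold_process_def)
  have step: "threshold_step V \<alpha> \<beta> (C t) (\<lambda>u v. f (g (G t) u) (g (G t) v)) (G t) (G (Suc t))" for t
    using assms(6) by (simp add: threshold_process_def)
  have g_mono: "g (G s) u \<le> g (G t) u"
    if "neighborhood (G s) u \<subseteq> neighborhood (G t) u" "u \<in> V" for s t u
    using assms(5) graph that unfolding degree_like_def by blast
  have f_mono: "f x y \<le> f x' y'" if "x \<le> x'" "y \<le> y'" for x x' y y'
  proof -
    have "f x y \<le> f x' y"
      using assms(4) that(1) by (auto simp: proper_def mono_def)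
    also have "\<dots> \<le> f x' y'"
      using assms(4) that(2) by (auto simp: proper_def mono_def)
    finally show ?thesis .
  qed
  have fin: "finite (nsets V 2)"
    using assms(1) by (simp add: finite_imp_finite_nsets)
  have "\<exists>T. \<forall>t\<ge>T. \<forall>p\<in>nsets V 2. (p \<in> G t) \<noteq> (p \<in> G (Suc t)) \<longrightarrow>
      (\<exists>\<^sub>F s in sequentially. p \<in> G s) \<and> (\<exists>\<^sub>F s in sequentially. p \<notin> G s)"
    using eventually_switch_imp_recurrent[OF fin, of G] unfolding eventually_sequentially .
  then obtain T where T: "\<And>t p. T \<le> t \<Longrightarrow> p \<in> nsets V 2 \<Longrightarrow> (p \<in> G t) \<noteq> (p \<in> G (Suc t)) \<Longrightarrow>
      (\<exists>\<^sub>F s in sequentially. p \<in> G s) \<and> (\<exists>\<^sub>F s in sequentially. p \<notin> G s)"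
    by blast
  have recur: "(\<exists>s\<ge>r. p \<in> G s) \<and> (\<exists>s\<ge>r. p \<notin> G s)"
    if "T \<le> t" "(p \<in> G t) \<noteq> (p \<in> G (Suc t))" for t p r
  proof -
    have "p \<in> nsets V 2"
      using that(2) graph by (auto simp: graph_on_def)
    with T[OF that(1)] that(2) show ?thesis
      by (auto simp: frequently_sequentially)
  qed

  \<comment> \<open>With ordered endpoints, each switched edge occurs in both orientations, so
    reading off one fixed component covers both endpoints.\<close>
  define gains where "gains = {(t, u, v). T \<le> t \<and> {u, v} \<notin> G t \<and> {u, v} \<in> G (Suc t)}"
  define losses where "losses = {(t, u, v). T \<le> t \<and> {u, v} \<in> G t \<and> {u, v} \<notin> G (Suc t)}"
  have gainsV: "u \<in> V \<and> v \<in> V \<and> u \<noteq> v" if "(t, u, v) \<in> gains" for t u v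
    using that graph_on_edgeD[OF graph] unfolding gains_def by blast
  have lossesV: "u \<in> V \<and> v \<in> V \<and> u \<noteq> v" if "(t, u, v) \<in> losses" for t u v
    using that graph_on_edgeD[OF graph] unfolding losses_def by blast

  have loss_after_gain: "\<exists>q x. (q, u, x) \<in> losses \<and> g (G r) u \<le> g (G q) u"
    if gain: "(r, u, v) \<in> gains" for r u v
  proof -
    from gain have r: "T \<le> r" "{u, v} \<notin> G r" "{u, v} \<in> G (Suc r)"
      by (auto simp: gains_def)
    with recur[of r "{u, v}" "Suc r"] obtain s where "Suc r \<le> s" "{u, v} \<notin> G s"
      by blast
    \<comment> \<open>The pair \<open>{u, v}\<close> is absent at \<open>r\<close> and present only
      from \<open>Suc r\<close>, so its later loss is sought from \<open>Suc r\<close>. The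
      neighborhoods are compared from \<open>r\<close>, the time at which the energy of the
      insertion is evaluated.\<close>
    with r obtain q x where "r \<le> q" "neighborhood (G r) u \<subseteq> neighborhood (G q) u"
      "x \<in> neighborhood (G q) u" "x \<notin> neighborhood (G (Suc q)) u"
      using first_loss[of v "\<lambda>t. neighborhood (G t) u" "Suc r" s r]
      by (auto simp: neighborhood_def)
    then have "(q, u, x) \<in> losses" "g (G r) u \<le> g (G q) u"
      using r(1) g_mono gainsV[OF gain] by (auto simp: losses_def neighborhood_def)
    then show ?thesis
      by blast
  qed
  \<comment> \<open>Dual argument at the second endpoint, which stays in second position because
    \<open>gain_vals\<close> reads that component.\<close>
  have gain_after_loss: "\<exists>q x. (q, x, v) \<in> gains \<and> g (G q) v \<le> g (G r) v"
    if loss: "(r, u, v) \<in> losses" for r u v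
  proof -
    from loss have r: "T \<le> r" "{u, v} \<in> G r" "{u, v} \<notin> G (Suc r)"
      by (auto simp: losses_def)
    with recur[of r "{u, v}" "Suc r"] obtain s where "Suc r \<le> s" "{u, v} \<in> G s"
      by blast
    with r obtain q x where "r \<le> q" "neighborhood (G q) v \<subseteq> neighborhood (G r) v"
      "x \<notin> neighborhood (G q) v" "x \<in> neighborhood (G (Suc q)) v"
      using first_gain[of u "\<lambda>t. neighborhood (G t) v" "Suc r" s r]
      by (auto simp: neighborhood_def insert_commute)
    then have "(q, x, v) \<in> gains" "g (G q) v \<le> g (G r) v"
      using r(1) g_mono lossesV[OF loss]
      by (auto simp: gains_def neighborhood_def insert_commute)
    then show ?thesis
      by blast
  qed

  define gain_vals where "gain_vals = (\<lambda>(t, u, v). g (G t) v) ` gains"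
  define loss_vals where "loss_vals = (\<lambda>(t, u, v). g (G t) u) ` losses"
  \<comment> \<open>Times are unbounded, but only finitely many graphs and vertices occur as
    arguments of \<open>g\<close>; hence the minimum and maximum exist.\<close>
  have "finite ((\<lambda>(H, u). g H u) ` (Pow (nsets V 2) \<times> V))"
    using fin assms(1) by blast
  moreover have "gain_vals \<subseteq> (\<lambda>(H, u). g H u) ` (Pow (nsets V 2) \<times> V)"
    using gainsV graph by (fastforce simp: gain_vals_def graph_on_def)
  moreover have "loss_vals \<subseteq> (\<lambda>(H, u). g H u) ` (Pow (nsets V 2) \<times> V)"
    using lossesV graph by (fastforce simp: loss_vals_def graph_on_def)
  ultimately have fin_vals: "finite gain_vals" "finite loss_vals"
    using finite_subset by blast+

  obtain p where p: "(p \<in> G T) \<noteq> (p \<in> G (Suc T))"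
    using never[of T] by blast
  then obtain u v where "p = {u, v}"
    using graph_on_edgeE[OF graph] by metis
  with p have "(T, u, v) \<in> gains \<or> (T, u, v) \<in> losses"
    by (auto simp: gains_def losses_def)
  \<comment> \<open>A switch of either kind at time \<open>T\<close> suffices, since gains and
    losses each produce the other.\<close>
  then have ne: "gains \<noteq> {}" "losses \<noteq> {}"
    using loss_after_gain gain_after_loss by blast+

  have "Min gain_vals \<in> gain_vals"
    using ne fin_vals by (simp add: gain_vals_def)
  then obtain r u v where gain: "(r, u, v) \<in> gains" and m: "g (G r) v = Min gain_vals"
    by (auto simp: gain_vals_def)
  have "Max loss_vals \<in> loss_vals"
    using ne fin_vals by (simp add: loss_vals_def)
  then obtain s u' v' where loss: "(s, u', v') \<in> losses" and M: "g (G s) u' = Max loss_vals"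
    by (auto simp: loss_vals_def)

  obtain q x where q: "(q, u, x) \<in> losses" "g (G r) u \<le> g (G q) u"
    using loss_after_gain[OF gain] by blast
  \<comment> \<open>The loss at \<open>q\<close> has \<open>u\<close> in first position, so its
    value at \<open>u\<close> belongs to \<open>loss_vals\<close>.\<close>
  then have "g (G q) u \<le> Max loss_vals"
    using fin_vals by (force simp: loss_vals_def intro: Max_ge)
  with q M have a: "g (G r) u \<le> g (G s) u'"
    by linarith
  obtain q' x' where q': "(q', x', v') \<in> gains" "g (G q') v' \<le> g (G s) v'"
    using gain_after_loss[OF loss] by blast
  then have "Min gain_vals \<le> g (G q') v'"
    using fin_vals by (force simp: gain_vals_def intro: Min_le)
  with q' m have b: "g (G r) v \<le> g (G s) v'"
    by linarith

  have "\<beta> \<le> f (g (G r) u) (g (G r) v)"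
    using threshold_step_gain[OF step] gain gainsV[OF gain] by (simp add: gains_def)
  also have "\<dots> \<le> f (g (G s) u') (g (G s) v')"
    by (rule f_mono[OF a b])
  also have "\<dots> < \<alpha>"
    using threshold_step_loss[OF step] loss lossesV[OF loss] by (simp add: losses_def)
  finally show False
    using assms(2) by simp
qed

end
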